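(* Let $G$ be an $\alpha$-weakly-Helly graph and let $H=\mathcal{H}(G)$ be its injective hull. For every integer $\ell\ge 0$ and every $M\subseteq V(G)$, $$diam_G(C_G^{\ell}(M))-2\alpha\ \le\ diam_H(C_H^{\ell}(M))\ \le\ diam_G(C_G^{\alpha+\ell}(M))+2\alpha.$$
   Context: All graphs are finite, simple, undirected, unweighted and connected. $D_G(v,r)=\{u: d_G(u,v)\le r\}$. A graph $G$ is $\alpha$-weakly-Helly if for every family of pairwise intersecting disks $\{D_G(v,r(v)) : v\in S\}$ the disks $D_G(v,r(v)+\alpha)$, $v\in S$, have a common vertex; Helly graphs are the $0$-weakly-Helly graphs. The injective hull $\mathcal{H}(G)$ is the unique minimal Helly graph containing $G$ as an isometric subgraph; $V(G)$ is identified with its image in $\mathcal{H}(G)$. For a graph $X$ containing $M$ (here $X\in\{G,H\}$) and $v\in V(X)$: $e_X^M(v)=\max_{u\in M}d_X(v,u)$, $rad_X(M)=\min_{v\in V(X)}e_X^M(v)$, $C_X^{\ell}(M)=\{v\in V(X): e_X^M(v)\le rad_X(M)+\ell\}$. For $S\subseteq V(X)$, $diam_X(S)=\max_{u,v\in S}d_X(u,v)$. *)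

theory Defs
  imports "Graph_Theory.Graph_Theory"
begin

text \<open>
  Finite simple undirected graphs are symmetric loop-free digraphs without parallel arcs
  (\<^locale>\<open>pair_graph\<close>). A connected graph is non-empty by
  \<^const>\<open>Digraph_Component.connected\<close>.
\<close>

definition connected_graph :: "'a pair_pre_digraph \<Rightarrow> bool" where
  "connected_graph G \<longleftrightarrow> pair_graph G \<and> Digraph_Component.connected (with_proj G)"

definition gdist :: "'a pair_pre_digraph \<Rightarrow> 'a \<Rightarrow> 'a \<Rightarrow> nat" where
  "gdist G u v = (LEAST n. \<exists>p. pre_digraph.awalk (with_proj G) u p v \<and> length p = n)"

text \<open>Agreement with the shortest-path distance of the library for unit weights.\<close>

lemma gdist_eq_mu:
  assumes "connected_graph G" "u \<in> pverts G" "v \<in> pverts G"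
  shows "wf_digraph.\<mu> (with_proj G) (\<lambda>_. 1) u v = ereal (real (gdist G u v))"
proof -
  from assms interpret pair_graph G by (simp add: connected_graph_def)
  have cost: "awalk_cost (\<lambda>_. 1) p = real (length p)" for p
    by (induct p) auto
  have "u \<rightarrow>\<^sup>*\<^bsub>with_proj G\<^esub> v"
    using assms symmetric_connected_imp_strongly_connected[OF pair_sym_arcs]
    unfolding connected_graph_def strongly_connected_def with_proj_simps by blast
  then obtain p where "awalk u p v"
    unfolding reachable_awalk by blast
  then have "\<exists>n q. awalk u q v \<and> length q = n"
    by blast
  then have "\<exists>q. awalk u q v \<and> length q = gdist G u v"
    unfolding gdist_def by (rule LeastI_ex)
  then obtain q where q: "awalk u q v" "length q = gdist G u v"
    by blast
  have le: "gdist G u v \<le> length p" if "awalk u p v" for p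
    unfolding gdist_def by (rule Least_le) (use that in blast)
  show ?thesis
    unfolding \<mu>_def
  proof (rule antisym)
    show "(INF p\<in>{p. awalk u p v}. ereal (awalk_cost (\<lambda>_. 1) p)) \<le> ereal (real (gdist G u v))"
      by (rule INF_lower2[of q]) (simp_all add: q cost)
    show "ereal (real (gdist G u v)) \<le> (INF p\<in>{p. awalk u p v}. ereal (awalk_cost (\<lambda>_. 1) p))"
      by (rule INF_greatest) (simp add: le cost)
  qed
qed

definition disk :: "'a pair_pre_digraph \<Rightarrow> 'a \<Rightarrow> nat \<Rightarrow> 'a set" where
  "disk G v r = {u \<in> pverts G. gdist G u v \<le> r}"

definition weakly_Helly :: "nat \<Rightarrow> 'a pair_pre_digraph \<Rightarrow> bool" where
  "weakly_Helly \<alpha> G \<longleftrightarrow> connected_graph G \<and>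
     (\<forall>S r. S \<subseteq> pverts G \<longrightarrow>
        (\<forall>u\<in>S. \<forall>v\<in>S. disk G u (r u) \<inter> disk G v (r v) \<noteq> {}) \<longrightarrow>
        (\<exists>x\<in>pverts G. \<forall>v\<in>S. x \<in> disk G v (r v + \<alpha>)))"

definition Helly :: "'a pair_pre_digraph \<Rightarrow> bool" where
  "Helly G \<longleftrightarrow> weakly_Helly 0 G"

text \<open>
  For connected graphs, preservation of distances makes \<open>\<iota>\<close> injective and adjacency preserving
  in both directions, so the image of \<open>G\<close> is an isometric subgraph of \<open>H\<close>.
\<close>

definition isometric_embedding ::
    "('a \<Rightarrow> 'b) \<Rightarrow> 'a pair_pre_digraph \<Rightarrow> 'b pair_pre_digraph \<Rightarrow> bool" where
  "isometric_embedding \<iota> G H \<longleftrightarrow> \<iota> ` pverts G \<subseteq> pverts H \<and>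
     (\<forall>u\<in>pverts G. \<forall>v\<in>pverts G. gdist H (\<iota> u) (\<iota> v) = gdist G u v)"

text \<open>
  \<open>H\<close> is a minimal Helly graph containing \<open>G\<close>, identified with its image under \<open>\<iota>\<close>, as an
  isometric subgraph. The injective hull is determined only up to isomorphism over \<open>G\<close>, hence
  a predicate rather than a function. The type of \<open>H\<close> is independent of that of \<open>G\<close>, since the
  hull usually has more vertices than \<open>G\<close>.
\<close>

definition injective_hull ::
    "('a \<Rightarrow> 'b) \<Rightarrow> 'a pair_pre_digraph \<Rightarrow> 'b pair_pre_digraph \<Rightarrow> bool" where
  "injective_hull \<iota> G H \<longleftrightarrow> Helly H \<and> isometric_embedding \<iota> G H \<and>
     (\<forall>K. subgraph (with_proj K) (with_proj H) \<and> Helly K \<and> isometric_embedding \<iota> G K \<longrightarrow> K = H)"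

text \<open>
  For \<open>M = {}\<close> all eccentricities are the same number \<^term>\<open>Max {} :: nat\<close>, so that every
  vertex lies in \<open>center X M l\<close>, exactly as under the convention that an empty maximum is 0.
\<close>

definition ecc :: "'a pair_pre_digraph \<Rightarrow> 'a set \<Rightarrow> 'a \<Rightarrow> nat" where
  "ecc X M v = Max (gdist X v ` M)"

definition rad :: "'a pair_pre_digraph \<Rightarrow> 'a set \<Rightarrow> nat" where
  "rad X M = Min (ecc X M ` pverts X)"

definition center :: "'a pair_pre_digraph \<Rightarrow> 'a set \<Rightarrow> nat \<Rightarrow> 'a set" where
  "center X M l = {v \<in> pverts X. ecc X M v \<le> rad X M + l}"

definition diam :: "'a pair_pre_digraph \<Rightarrow> 'a set \<Rightarrow> nat" where
  "diam X S = Max {gdist X u v | u v. u \<in> S \<and> v \<in> S}"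

end

theory Submission
  imports Defs
begin

text \<open>
  Minimality of the hull makes every vertex \<open>x\<close> of \<open>H\<close> tight over \<open>G\<close>: for each \<open>y\<close> in \<open>G\<close>, some
  geodesic from \<open>y\<close> to a vertex \<open>u\<close> of \<open>G\<close> passes through \<open>x\<close>. Indeed the tight vertices induce a
  Helly isometric subgraph, because among the common vertices of disks with tight centres one that
  minimises the sum of the distances to \<open>G\<close> is itself tight. Applying the weak Helly property of \<open>G\<close>
  to the disks around all \<open>v\<close> of radius \<open>d(x,v)\<close> gives \<open>y\<close> in \<open>G\<close> with \<open>d(y,v) \<le> d(x,v) + \<alpha>\<close>, and
  tightness at \<open>y\<close> turns this into \<open>d(x,y) \<le> \<alpha>\<close>. Since \<open>rad\<^sub>H(M) \<le> rad\<^sub>G(M)\<close>, moving a pair of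
  vertices of the center of \<open>H\<close> to near vertices of \<open>G\<close> proves the upper bound.
  For the lower bound, \<open>rad\<^sub>G(M) \<le> rad\<^sub>H(M) + \<alpha>\<close>, so for \<open>u\<close> in the center of \<open>G\<close> the disk of radius
  \<open>\<alpha>\<close> around \<open>u\<close> and the disks of radius \<open>rad\<^sub>H(M) + l\<close> around \<open>M\<close> meet pairwise, and the Helly
  property of \<open>H\<close> moves \<open>u\<close> by at most \<open>\<alpha>\<close> into the center of \<open>H\<close>.
\<close>

section \<open>Distances in connected graphs\<close>

lemma gdist_le:
  assumes "pre_digraph.awalk (with_proj G) u p v"
  shows "gdist G u v \<le> length p"
  unfolding gdist_def by (rule Least_le) (use assms in blast)

lemma gdist_attained:
  assumes "connected_graph G" "u \<in> pverts G" "v \<in> pverts G"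
  obtains p where "pre_digraph.awalk (with_proj G) u p v" "length p = gdist G u v"
proof -
  from assms interpret pair_graph G by (simp add: connected_graph_def)
  have "u \<rightarrow>\<^sup>*\<^bsub>with_proj G\<^esub> v"
    using assms symmetric_connected_imp_strongly_connected[OF pair_sym_arcs]
    unfolding connected_graph_def strongly_connected_def with_proj_simps by blast
  then have "\<exists>n p. awalk u p v \<and> length p = n"
    unfolding reachable_awalk by blast
  then have "\<exists>p. awalk u p v \<and> length p = gdist G u v"
    unfolding gdist_def by (rule LeastI_ex)
  then show thesis
    using that by blast
qed

lemma finite_pverts: "connected_graph G \<Longrightarrow> finite (pverts G)"
  by (simp add: connected_graph_def pair_fin_digraph.pair_finite_verts pair_graph_def pair_digraph_def)

lemma pverts_nonempty: "connected_graph G \<Longrightarrow> pverts G \<noteq> {}"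
  by (auto simp: connected_graph_def Digraph_Component.connected_def strongly_connected_def)

lemma gdist_self [simp]: "u \<in> pverts G \<Longrightarrow> gdist G u u = 0"
  using gdist_le[of G u "[]" u] by (simp add: pre_digraph.awalk_def pre_digraph.cas.simps)

lemma gdist_commute:
  assumes G: "connected_graph G" and uv: "u \<in> pverts G" "v \<in> pverts G"
  shows "gdist G u v = gdist G v u"
proof -
  from G interpret pair_graph G by (simp add: connected_graph_def)
  have len: "length (rev_path p) = length p" for p :: "('a \<times> 'a) list"
    by (induct p) auto
  have "gdist G x y \<le> gdist G y x" if xy: "x \<in> pverts G" "y \<in> pverts G" for x y
  proof -
    obtain p where p: "awalk y p x" "length p = gdist G y x"
      using gdist_attained[OF G xy(2,1)] .
    from p(1) have "awalk x (rev_path p) y" by simp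
    from gdist_le[OF this] show ?thesis by (simp add: len p(2))
  qed
  with uv show ?thesis by (simp add: antisym)
qed

lemma gdist_triangle:
  assumes G: "connected_graph G" and "u \<in> pverts G" "v \<in> pverts G" "w \<in> pverts G"
  shows "gdist G u w \<le> gdist G u v + gdist G v w"
proof -
  from G interpret pair_graph G by (simp add: connected_graph_def)
  obtain p where p: "awalk u p v" "length p = gdist G u v"
    using gdist_attained[OF assms(1-3)] .
  obtain q where q: "awalk v q w" "length q = gdist G v w"
    using gdist_attained[OF assms(1,3,4)] .
  show ?thesis
    using gdist_le[OF awalk_appendI[OF p(1) q(1)]] p(2) q(2) by simp
qed

lemma arc_if_gdist_1:
  assumes G: "connected_graph G" and uv: "u \<in> pverts G" "v \<in> pverts G" "gdist G u v = 1"
  shows "(u, v) \<in> parcs G"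
proof -
  from G interpret pair_graph G by (simp add: connected_graph_def)
  obtain p where "awalk u p v" "length p = 1"
    using gdist_attained[OF G uv(1,2)] uv(3) by metis
  then show ?thesis
    by (auto simp: length_Suc_conv awalk_simps)
qed

text \<open>A geodesic is cut after \<open>r\<close> arcs; if it is shorter than that,
  \<open>take r p\<close> is all of it and \<open>w\<close> is \<open>v\<close>.\<close>

lemma gdist_split:
  assumes G: "connected_graph G" and uv: "u \<in> pverts G" "v \<in> pverts G"
    and le: "gdist G u v \<le> r + s"
  obtains w where "w \<in> pverts G" "gdist G u w \<le> r" "gdist G w v \<le> s"
proof -
  from G interpret pair_graph G by (simp add: connected_graph_def)
  obtain p where p: "awalk u p v" "length p = gdist G u v"
    using gdist_attained[OF G uv] .
  then obtain w where w: "awalk u (take r p) w" "awalk w (drop r p) v"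
    by (metis append_take_drop_id awalk_append_iff)
  show thesis
  proof
    show "w \<in> pverts G" using w(1) by (rule awalk_last_in_verts)
    show "gdist G u w \<le> r" using gdist_le[OF w(1)] by simp
    show "gdist G w v \<le> s" using gdist_le[OF w(2)] p(2) le by simp
  qed
qed

section \<open>Weakly Helly graphs\<close>

lemma weakly_Helly_imp_connected: "weakly_Helly \<alpha> G \<Longrightarrow> connected_graph G"
  by (simp add: weakly_Helly_def)

text \<open>The vertices of a geodesic realise every integral split of its length. Intersection
  becomes a condition on distances alone, so it carries over between a graph and an isometric
  subgraph.\<close>

lemma disks_meet_iff:
  assumes G: "connected_graph G" and uv: "u \<in> pverts G" "v \<in> pverts G"
  shows "disk G u r \<inter> disk G v s \<noteq> {} \<longleftrightarrow> gdist G u v \<le> r + s"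
proof
  assume "disk G u r \<inter> disk G v s \<noteq> {}"
  then obtain w where "w \<in> pverts G" "gdist G w u \<le> r" "gdist G w v \<le> s"
    by (auto simp: disk_def)
  then show "gdist G u v \<le> r + s"
    using gdist_triangle[OF G uv(1) _ uv(2), of w] gdist_commute[OF G uv(1), of w] by simp
next
  assume "gdist G u v \<le> r + s"
  then obtain w where "w \<in> pverts G" "gdist G u w \<le> r" "gdist G w v \<le> s"
    using gdist_split[OF G uv] by blast
  then have "w \<in> disk G u r \<inter> disk G v s"
    using gdist_commute[OF G uv(1), of w] by (simp add: disk_def)
  then show "disk G u r \<inter> disk G v s \<noteq> {}" by blast
qed

text \<open>Disks are given as pairs, so that one centre may carry several radii.\<close>

lemma weakly_Helly_common_vertex:
  assumes wH: "weakly_Helly \<alpha> G" and F: "fst ` F \<subseteq> pverts G"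
    and meet: "\<And>u r v s. (u, r) \<in> F \<Longrightarrow> (v, s) \<in> F \<Longrightarrow> gdist G u v \<le> r + s"
  obtains x where "x \<in> pverts G" "\<And>v r. (v, r) \<in> F \<Longrightarrow> gdist G x v \<le> r + \<alpha>"
proof -
  note G = weakly_Helly_imp_connected[OF wH]
  \<comment> \<open>The smallest disk around a centre lies in all the others around it, so one
    radius per centre suffices.\<close>
  define r where "r v = (LEAST n. (v, n) \<in> F)" for v
  have rF: "(v, r v) \<in> F" if "v \<in> fst ` F" for v
    unfolding r_def by (rule LeastI_ex) (use that in force)
  have "\<forall>u\<in>fst ` F. \<forall>v\<in>fst ` F. disk G u (r u) \<inter> disk G v (r v) \<noteq> {}"
  proof (intro ballI)
    fix u v assume uv: "u \<in> fst ` F" "v \<in> fst ` F"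
    then have "u \<in> pverts G" "v \<in> pverts G" using F by blast+
    then show "disk G u (r u) \<inter> disk G v (r v) \<noteq> {}"
      unfolding disks_meet_iff[OF G \<open>u \<in> pverts G\<close> \<open>v \<in> pverts G\<close>]
      using meet rF uv by blast
  qed
  with wH F obtain x where x: "x \<in> pverts G" "\<forall>v\<in>fst ` F. x \<in> disk G v (r v + \<alpha>)"
    unfolding weakly_Helly_def by blast
  show thesis
  proof
    show "x \<in> pverts G" by fact
    fix v s assume vs: "(v, s) \<in> F"
    then have v: "v \<in> fst ` F" by force
    have "r v \<le> s" unfolding r_def by (rule Least_le) (fact vs)
    moreover have "gdist G x v \<le> r v + \<alpha>" using bspec[OF x(2) v] by (simp add: disk_def)
    ultimately show "gdist G x v \<le> s + \<alpha>" by simp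
  qed
qed

lemma Helly_common_vertex:
  assumes "Helly G" and "fst ` F \<subseteq> pverts G"
    and "\<And>u r v s. (u, r) \<in> F \<Longrightarrow> (v, s) \<in> F \<Longrightarrow> gdist G u v \<le> r + s"
  obtains x where "x \<in> pverts G" "\<And>v r. (v, r) \<in> F \<Longrightarrow> gdist G x v \<le> r"
  using weakly_Helly_common_vertex[OF assms(1)[unfolded Helly_def] assms(2,3)] by auto

lemma Helly_imp_connected: "Helly G \<Longrightarrow> connected_graph G"
  by (simp add: Helly_def weakly_Helly_def)

section \<open>Induced subgraphs of Helly graphs\<close>

definition induced_on :: "'a pair_pre_digraph \<Rightarrow> 'a set \<Rightarrow> 'a pair_pre_digraph" where
  "induced_on H S = \<lparr>pverts = S, parcs = parcs H \<inter> S \<times> S\<rparr>"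

lemma induced_on_simps [simp]:
  "pverts (induced_on H S) = S"
  "parcs (induced_on H S) = parcs H \<inter> S \<times> S"
  by (simp_all add: induced_on_def)

lemma pair_graph_induced_on:
  assumes "pair_graph H" and "S \<subseteq> pverts H"
  shows "pair_graph (induced_on H S)"
proof -
  from assms(1) interpret H: pair_graph H .
  show ?thesis
  proof
    show "finite (pverts (induced_on H S))" "finite (parcs (induced_on H S))"
      using finite_subset[OF assms(2) H.pair_finite_verts] H.pair_finite_arcs by simp_all
    show "symmetric (with_proj (induced_on H S))"
      using H.pair_sym_arcs by (auto simp: symmetric_def sym_def)
  qed (use H.pair_no_loops in auto)
qed

lemma subgraph_induced_on:
  assumes "pair_graph H" and "S \<subseteq> pverts H"
  shows "subgraph (with_proj (induced_on H S)) (with_proj H)"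
proof -
  from assms(1) interpret H: pair_graph H .
  interpret K: pair_graph "induced_on H S"
    using assms by (rule pair_graph_induced_on)
  show ?thesis
    using assms(2) H.wf_digraph K.wf_digraph by (auto simp: subgraph_def compatible_def)
qed

text \<open>
  Isometry comes from the Helly property for two disks: a disk of radius 1 around \<open>u\<close> and one of
  radius \<open>d(u,v) - 1\<close> around \<open>v\<close> meet in \<open>S\<close>, which gives the first step of a geodesic inside \<open>S\<close>.
\<close>

lemma Helly_induced_on:
  assumes H: "connected_graph H" and S: "S \<subseteq> pverts H" "S \<noteq> {}"
    and common: "\<And>F. fst ` F \<subseteq> S \<Longrightarrow>
      (\<And>u r v s. (u, r) \<in> F \<Longrightarrow> (v, s) \<in> F \<Longrightarrow> gdist H u v \<le> r + s) \<Longrightarrow>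
      \<exists>x\<in>S. \<forall>(v, r)\<in>F. gdist H x v \<le> r"
  shows "Helly (induced_on H S)"
    and "\<And>u v. u \<in> S \<Longrightarrow> v \<in> S \<Longrightarrow> gdist (induced_on H S) u v = gdist H u v"
proof -
  let ?K = "induced_on H S"
  from H interpret H: pair_graph H by (simp add: connected_graph_def)
  interpret K: pair_graph ?K
    using H.pair_graph S(1) by (rule pair_graph_induced_on)
  \<comment> \<open>The induction is over an upper bound \<open>n\<close>, not over the exact
    distance: the common vertex of the two disks may be \<open>u\<close> itself, in which case no
    arc is added.\<close>
  have walk: "\<exists>p. K.awalk u p v \<and> length p \<le> n"
    if "u \<in> S" "v \<in> S" "gdist H u v \<le> n" for u v n
    using that
  proof (induction n arbitrary: u)
    case 0
    then have "u = v"
      using gdist_attained[OF H, of u v] S(1) by (auto simp: H.awalk_Nil_iff)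
    with 0 have "K.awalk u [] v" by (simp add: K.awalk_Nil_iff)
    then show ?case by force
  next
    case (Suc n)
    have uH: "u \<in> pverts H" "v \<in> pverts H" using Suc.prems S(1) by auto
    have "\<exists>x\<in>S. \<forall>(w, r)\<in>{(u, 1), (v, n)}. gdist H x w \<le> r"
      using Suc.prems S(1) uH gdist_commute[OF H uH] by (intro common) auto
    then obtain x where x: "x \<in> S" "gdist H x u \<le> 1" "gdist H x v \<le> n"
      by auto
    from Suc.IH[OF x(1) Suc.prems(2) x(3)] obtain p
      where p: "K.awalk x p v" "length p \<le> n" by blast
    have xH: "x \<in> pverts H" using x(1) S(1) by blast
    show ?case
    proof (cases "gdist H x u = 0")
      case True
      then have "x = u"
        using gdist_attained[OF H xH uH(1)] by (auto simp: H.awalk_Nil_iff)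
      with p show ?thesis by (auto intro: le_SucI)
    next
      case False
      then have "gdist H u x = 1"
        using x(2) gdist_commute[OF H uH(1) xH] by simp
      then have "(u, x) \<in> parcs H"
        using arc_if_gdist_1[OF H uH(1) xH] by simp
      then have "K.awalk u ((u, x) # p) v"
        using p(1) x(1) Suc.prems(1) by (simp add: K.awalk_Cons_iff)
      with p(2) show ?thesis by force
    qed
  qed
  have "u \<rightarrow>\<^sup>*\<^bsub>with_proj ?K\<^esub> v" if "u \<in> S" "v \<in> S" for u v
    using walk[OF that order_refl] K.reachable_awalkI by blast
  then have "Digraph_Component.connected (with_proj ?K)"
    using S(2) K.reachable_mk_symmetric_eq[OF K.pair_sym_arcs] by (intro K.connectedI) auto
  then have K: "connected_graph ?K"
    unfolding connected_graph_def using K.pair_graph by blast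
  show dist: "gdist ?K u v = gdist H u v" if uv: "u \<in> S" "v \<in> S" for u v
  proof (rule antisym)
    obtain q where "K.awalk u q v" "length q \<le> gdist H u v"
      using walk[OF uv order_refl] by blast
    then show "gdist ?K u v \<le> gdist H u v"
      using gdist_le[of ?K u q v] by simp
    obtain p where p: "K.awalk u p v" "length p = gdist ?K u v"
      using gdist_attained[OF K, of u v] uv by auto
    have "H.awalk u p v"
      using p(1) subgraph_induced_on[OF H.pair_graph S(1)] by (rule H.subgraph_awalk_imp_awalk)
    with p(2) show "gdist H u v \<le> gdist ?K u v"
      using gdist_le[of H u p v] by simp
  qed
  show "Helly ?K"
    unfolding Helly_def weakly_Helly_def
  proof (intro conjI allI impI)
    fix T r
    assume T: "T \<subseteq> pverts ?K"
      and meet: "\<forall>u\<in>T. \<forall>v\<in>T. disk ?K u (r u) \<inter> disk ?K v (r v) \<noteq> {}"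
    have TS: "T \<subseteq> S" using T by simp
    let ?F = "(\<lambda>v. (v, r v)) ` T"
    have "\<exists>x\<in>S. \<forall>(v, r)\<in>?F. gdist H x v \<le> r"
    proof (rule common)
      show "fst ` ?F \<subseteq> S" using TS by auto
      fix u a v b assume "(u, a) \<in> ?F" "(v, b) \<in> ?F"
      then have uv: "u \<in> T" "v \<in> T" "a = r u" "b = r v" by auto
      then have "gdist ?K u v \<le> a + b"
        using meet disks_meet_iff[OF K, of u v] T by blast
      then show "gdist H u v \<le> a + b"
        using dist uv TS by (metis subsetD)
    qed
    then obtain x where x: "x \<in> S" "\<And>v. v \<in> T \<Longrightarrow> gdist H x v \<le> r v" by auto
    have "x \<in> disk ?K v (r v + 0)" if "v \<in> T" for v
      using x that TS dist[OF x(1), of v] by (auto simp: disk_def)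
    with x(1) show "\<exists>x\<in>pverts ?K. \<forall>v\<in>T. x \<in> disk ?K v (r v + 0)" by auto
  qed (fact K)
qed

section \<open>The injective hull\<close>

text \<open>In a connected graph this makes the function d(x,.) on \<open>A\<close> extremal: no
  value can be lowered while f(y) + f(u) \<ge> d(y,u) holds throughout. Such functions are the
  points of the tight span of \<open>A\<close>.\<close>

definition tight :: "'b pair_pre_digraph \<Rightarrow> 'b set \<Rightarrow> 'b set" where
  "tight H A = {x \<in> pverts H. \<forall>y\<in>A. \<exists>u\<in>A. gdist H y u = gdist H y x + gdist H x u}"

text \<open>Supplies the hypothesis \<open>common\<close> of \<open>Helly_induced_on\<close> for the
  set of tight vertices. If a common vertex \<open>z\<close> with least distance sum to
  \<open>A\<close> were not tight, a larger family of disks would yield a common vertex with a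
  smaller sum.\<close>

lemma tight_common_vertex:
  assumes Helly: "Helly H" and A: "A \<subseteq> pverts H" and F: "fst ` F \<subseteq> tight H A"
    and meet: "\<And>u r v s. (u, r) \<in> F \<Longrightarrow> (v, s) \<in> F \<Longrightarrow> gdist H u v \<le> r + s"
  obtains x where "x \<in> tight H A" "\<And>v r. (v, r) \<in> F \<Longrightarrow> gdist H x v \<le> r"
proof -
  note H = Helly_imp_connected[OF Helly]
  note tri = gdist_triangle[OF H] and comm = gdist_commute[OF H]
  have finA: "finite A" using A finite_pverts[OF H] finite_subset by blast
  have FH: "v \<in> pverts H" if "(v, r) \<in> F" for v r
    using F that by (force simp: tight_def)
  define P where "P z \<longleftrightarrow> z \<in> pverts H \<and> (\<forall>(v, r)\<in>F. gdist H z v \<le> r)" for z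
  have "fst ` F \<subseteq> pverts H" using FH by force
  then obtain z0 where "z0 \<in> pverts H" "\<And>v r. (v, r) \<in> F \<Longrightarrow> gdist H z0 v \<le> r"
    using Helly_common_vertex[OF Helly _ meet] by blast
  then have "P z0" by (auto simp: P_def)
  then obtain z where Pz: "P z"
    and min: "\<And>w. P w \<Longrightarrow> (\<Sum>v\<in>A. gdist H z v) \<le> (\<Sum>v\<in>A. gdist H w v)"
    using ex_has_least_nat[of P z0 "\<lambda>z. \<Sum>v\<in>A. gdist H z v"] by blast
  have z: "z \<in> pverts H" and zF: "\<And>v r. (v, r) \<in> F \<Longrightarrow> gdist H z v \<le> r"
    using Pz by (auto simp: P_def)
  have "z \<in> tight H A"
  proof (rule ccontr)
    assume "z \<notin> tight H A"
    then obtain y where y: "y \<in> A"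
      and ne: "\<And>u. u \<in> A \<Longrightarrow> gdist H y u \<noteq> gdist H y z + gdist H z u"
      using z by (auto simp: tight_def)
    have yH: "y \<in> pverts H" using y A by blast
    have less: "gdist H y u < gdist H z y + gdist H z u" if "u \<in> A" for u
      using tri[OF yH z, of u] ne[OF that] comm[OF yH z] that A by fastforce
    \<comment> \<open>The instance u = y; it keeps the natural subtraction in \<open>F'\<close> from
      truncating.\<close>
    have pos: "gdist H z y \<ge> 1" using less[OF y] by simp
    \<comment> \<open>\<open>z\<close> is not tight at \<open>y\<close>, so the radius at \<open>y\<close> can be lowered by one, against minimality.\<close>
    define F' where "F' = insert (y, gdist H z y - 1) (F \<union> (\<lambda>v. (v, gdist H z v)) ` A)"
    have F'H: "v \<in> pverts H" if "(v, r) \<in> F'" for v r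
      using that FH yH A by (auto simp: F'_def)
    have zF': "gdist H z v \<le> r" if "(v, r) \<in> F \<union> (\<lambda>v. (v, gdist H z v)) ` A" for v r
      using that zF by auto
    have new: "gdist H y v \<le> gdist H z y - 1 + r" if vr: "(v, r) \<in> F'" for v r
    proof -
      consider "(v, r) \<in> F" | "v \<in> A" "r = gdist H z v" | "v = y"
        using vr by (auto simp: F'_def)
      then show ?thesis
      proof cases
        case 1
        \<comment> \<open>Tightness of the centre \<open>v\<close> prolongs a geodesic from
          \<open>y\<close> to \<open>v\<close> up to some \<open>u\<close> in \<open>A\<close>,
          where the strict inequality \<open>less\<close> is available.\<close>
        then have "v \<in> tight H A" using F by force
        then obtain u where u: "u \<in> A" "gdist H y u = gdist H y v + gdist H v u"
          using y by (auto simp: tight_def)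
        have "gdist H z u \<le> gdist H z v + gdist H v u"
          using tri[OF z FH[OF 1], of u] u(1) A by blast
        then show ?thesis using less[OF u(1)] u(2) zF[OF 1] pos by linarith
      next
        case 2
        then show ?thesis using less[OF 2(1)] by simp
      next
        case 3
        then show ?thesis using yH by simp
      qed
    qed
    have "gdist H u v \<le> r + s" if uv: "(u, r) \<in> F'" "(v, s) \<in> F'" for u r v s
    proof -
      note uH = F'H[OF uv(1)] and vH = F'H[OF uv(2)]
      \<comment> \<open>Two disks that both contain \<open>z\<close> meet there; only pairs
        involving the lowered disk at \<open>y\<close> depend on \<open>new\<close>.\<close>
      consider "u = y" "r = gdist H z y - 1" | "v = y" "s = gdist H z y - 1"
        | "gdist H z u \<le> r" "gdist H z v \<le> s"
        using uv zF' unfolding F'_def by blast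
      then show ?thesis
      proof cases
        case 1
        then show ?thesis using new[OF uv(2)] by simp
      next
        case 2
        then show ?thesis using new[OF uv(1)] comm[OF uH vH] by simp
      next
        case 3
        then show ?thesis using tri[OF uH z vH] comm[OF uH z] by simp
      qed
    qed
    moreover have "fst ` F' \<subseteq> pverts H" using F'H by force
    ultimately obtain w where w: "w \<in> pverts H" "\<And>v r. (v, r) \<in> F' \<Longrightarrow> gdist H w v \<le> r"
      using Helly_common_vertex[OF Helly, of F'] by metis
    have "P w" using w by (auto simp: P_def F'_def)
    moreover have "(\<Sum>v\<in>A. gdist H w v) < (\<Sum>v\<in>A. gdist H z v)"
    proof (rule sum_strict_mono_ex1[OF finA])
      show "\<forall>v\<in>A. gdist H w v \<le> gdist H z v" using w(2) by (auto simp: F'_def)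
      have "gdist H w y \<le> gdist H z y - 1" using w(2) by (auto simp: F'_def)
      then show "\<exists>v\<in>A. gdist H w v < gdist H z v" using y pos by (intro bexI[of _ y]) auto
    qed
    ultimately show False using min by fastforce
  qed
  with zF show thesis using that by blast
qed

text \<open>The subgraph induced on the tight vertices is a Helly graph containing the image of G
  isometrically, so minimality of the hull makes it all of H.\<close>

lemma injective_hull_tight:
  assumes hull: "injective_hull \<iota> G H" and G: "connected_graph G"
  shows "tight H (\<iota> ` pverts G) = pverts H"
proof -
  let ?A = "\<iota> ` pverts G" and ?S = "tight H (\<iota> ` pverts G)"
  have Helly: "Helly H" and emb: "isometric_embedding \<iota> G H"
    using hull by (auto simp: injective_hull_def)
  note H = Helly_imp_connected[OF Helly]
  have A: "?A \<subseteq> pverts H" using emb by (simp add: isometric_embedding_def)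
  have AS: "?A \<subseteq> ?S"
  proof
    fix x assume x: "x \<in> ?A"
    then have "x \<in> pverts H" using A by blast
    \<comment> \<open>For \<open>x\<close> in the image of G, the geodesic may end at
      \<open>x\<close> itself.\<close>
    then have "gdist H y x = gdist H y x + gdist H x x" for y by simp
    with x \<open>x \<in> pverts H\<close> show "x \<in> ?S" unfolding tight_def by blast
  qed
  have SH: "?S \<subseteq> pverts H" by (auto simp: tight_def)
  have "?S \<noteq> {}" using AS pverts_nonempty[OF G] by blast
  note K = Helly_induced_on[OF H SH this]
  have common: "\<exists>x\<in>?S. \<forall>(v, r)\<in>F. gdist H x v \<le> r"
    if F: "fst ` F \<subseteq> ?S" "\<And>u r v s. (u, r) \<in> F \<Longrightarrow> (v, s) \<in> F \<Longrightarrow> gdist H u v \<le> r + s" for F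
  proof -
    obtain x where "x \<in> ?S" "\<And>v r. (v, r) \<in> F \<Longrightarrow> gdist H x v \<le> r"
      using tight_common_vertex[OF Helly A F] by blast
    then show ?thesis by blast
  qed
  have "gdist (induced_on H ?S) (\<iota> u) (\<iota> v) = gdist G u v"
    if "u \<in> pverts G" "v \<in> pverts G" for u v
  proof -
    have "\<iota> u \<in> ?S" "\<iota> v \<in> ?S" using that AS by blast+
    then show ?thesis
      using K(2)[OF common] emb that by (simp add: isometric_embedding_def)
  qed
  then have "isometric_embedding \<iota> G (induced_on H ?S)"
    using AS by (simp add: isometric_embedding_def)
  moreover have "subgraph (with_proj (induced_on H ?S)) (with_proj H)"
    using H SH by (simp add: connected_graph_def subgraph_induced_on)
  ultimately have "induced_on H ?S = H"
    using hull K(1)[OF common] by (simp add: injective_hull_def)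
  then show ?thesis by (metis induced_on_simps(1))
qed

lemma injective_hull_near:
  assumes wH: "weakly_Helly \<alpha> G" and hull: "injective_hull \<iota> G H" and x: "x \<in> pverts H"
  obtains y where "y \<in> pverts G" "gdist H x (\<iota> y) \<le> \<alpha>"
proof -
  note G = weakly_Helly_imp_connected[OF wH]
  have H: "connected_graph H" and emb: "isometric_embedding \<iota> G H"
    using hull by (auto simp: injective_hull_def Helly_imp_connected)
  have \<iota>: "\<iota> v \<in> pverts H" if "v \<in> pverts G" for v
    using emb that by (auto simp: isometric_embedding_def)
  have iso: "gdist H (\<iota> u) (\<iota> v) = gdist G u v" if "u \<in> pverts G" "v \<in> pverts G" for u v
    using emb that by (auto simp: isometric_embedding_def)
  let ?F = "(\<lambda>v. (v, gdist H x (\<iota> v))) ` pverts G"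
  have "gdist G u v \<le> r + s" if "(u, r) \<in> ?F" "(v, s) \<in> ?F" for u r v s
    using that gdist_triangle[OF H \<iota> x \<iota>, of u v] gdist_commute[OF H \<iota> x, of u]
    by (auto simp: iso)
  moreover have "fst ` ?F \<subseteq> pverts G" by auto
  ultimately obtain y where y: "y \<in> pverts G"
    and yF: "\<And>v r. (v, r) \<in> ?F \<Longrightarrow> gdist G y v \<le> r + \<alpha>"
    using weakly_Helly_common_vertex[OF wH, of ?F] by blast
  have "x \<in> tight H (\<iota> ` pverts G)"
    using injective_hull_tight[OF hull G] x by simp
  then obtain u where u: "u \<in> pverts G"
    "gdist H (\<iota> y) (\<iota> u) = gdist H (\<iota> y) x + gdist H x (\<iota> u)"
    using y by (auto simp: tight_def)
  \<comment> \<open>By tightness the left side equals d(y,x) + d(x,u), and d(x,u) cancels.\<close>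
  have "gdist G y u \<le> gdist H x (\<iota> u) + \<alpha>" using yF u(1) by blast
  then have "gdist H x (\<iota> y) \<le> \<alpha>"
    using u iso[OF y u(1)] gdist_commute[OF H x \<iota>[OF y]] by linarith
  with y show thesis using that by blast
qed

section \<open>Centers and their diameters\<close>

lemma mem_center_iff:
  assumes X: "connected_graph X" and M: "M \<subseteq> pverts X"
  shows "v \<in> center X M l \<longleftrightarrow> v \<in> pverts X \<and> (\<forall>m\<in>M. gdist X v m \<le> rad X M + l)"
proof (cases "M = {}")
  case True
  \<comment> \<open>Every eccentricity, hence also the radius, is the same value
    \<open>Max {}\<close>, so both sides reduce to membership in \<open>pverts X\<close>.\<close>
  have "ecc X {} ` pverts X = {Max {}}"
    using pverts_nonempty[OF X] by (auto simp: ecc_def)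
  with True show ?thesis by (simp add: center_def rad_def ecc_def)
next
  case False
  have "finite M" using M finite_pverts[OF X] finite_subset by blast
  with False show ?thesis by (auto simp: center_def ecc_def)
qed

lemma center_nonempty:
  assumes X: "connected_graph X"
  shows "center X M l \<noteq> {}"
proof -
  have "rad X M \<in> ecc X M ` pverts X"
    unfolding rad_def using finite_pverts[OF X] pverts_nonempty[OF X] by (intro Min_in) auto
  then show ?thesis by (force simp: center_def)
qed

text \<open>\<open>M\<close> has to be nonempty here: otherwise the radius is \<open>Max {}\<close>,
  about which nothing is known.\<close>

lemma rad_le:
  assumes X: "connected_graph X" and M: "M \<subseteq> pverts X" "M \<noteq> {}"
    and v: "v \<in> pverts X" "\<And>m. m \<in> M \<Longrightarrow> gdist X v m \<le> n"
  shows "rad X M \<le> n"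
proof -
  have "finite M" using M finite_pverts[OF X] finite_subset by blast
  then have "ecc X M v \<le> n" using M(2) v(2) by (simp add: ecc_def)
  moreover have "rad X M \<le> ecc X M v"
    unfolding rad_def using finite_pverts[OF X] v(1) by simp
  ultimately show ?thesis by simp
qed

text \<open>Two vertices of \<open>M\<close> are joined through a central vertex. Hence disks of
  radius \<open>rad X M\<close> around \<open>M\<close> meet pairwise.\<close>

lemma gdist_le_two_rad:
  assumes X: "connected_graph X" and M: "M \<subseteq> pverts X" and m: "m \<in> M" "m' \<in> M"
  shows "gdist X m m' \<le> rad X M + rad X M"
proof -
  obtain c where "c \<in> center X M 0" using center_nonempty[OF X] by blast
  then have c: "c \<in> pverts X" "gdist X c m \<le> rad X M" "gdist X c m' \<le> rad X M"
    using m unfolding mem_center_iff[OF X M] by auto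
  have mX: "m \<in> pverts X" "m' \<in> pverts X" using m M by auto
  show ?thesis
    using gdist_triangle[OF X mX(1) c(1) mX(2)] gdist_commute[OF X mX(1) c(1)] c(2,3) by simp
qed

lemma diam_ge_gdist:
  assumes X: "connected_graph X" and S: "S \<subseteq> pverts X" and uv: "u \<in> S" "v \<in> S"
  shows "gdist X u v \<le> diam X S"
proof -
  have "finite S" using S finite_pverts[OF X] finite_subset by blast
  then have "finite {gdist X u v | u v. u \<in> S \<and> v \<in> S}"
    using finite_image_set2[of "\<lambda>u. u \<in> S" "\<lambda>v. v \<in> S"] by simp
  then show ?thesis unfolding diam_def using uv by (intro Max_ge) auto
qed

lemma diam_attained:
  assumes X: "connected_graph X" and S: "S \<subseteq> pverts X" "S \<noteq> {}"
  obtains u v where "u \<in> S" "v \<in> S" "diam X S = gdist X u v"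
proof -
  have "finite S" using S finite_pverts[OF X] finite_subset by blast
  then have "finite {gdist X u v | u v. u \<in> S \<and> v \<in> S}"
    using finite_image_set2[of "\<lambda>u. u \<in> S" "\<lambda>v. v \<in> S"] by simp
  moreover have "{gdist X u v | u v. u \<in> S \<and> v \<in> S} \<noteq> {}" using S(2) by auto
  ultimately have "diam X S \<in> {gdist X u v | u v. u \<in> S \<and> v \<in> S}"
    unfolding diam_def by (rule Max_in)
  then show thesis using that by blast
qed

lemma gdist_le_via:
  assumes X: "connected_graph X" and "u \<in> pverts X" "v \<in> pverts X" "u' \<in> pverts X" "v' \<in> pverts X"
  shows "gdist X u v \<le> gdist X u u' + gdist X u' v' + gdist X v v'"
proof -
  have "gdist X u v \<le> gdist X u u' + gdist X u' v"
    by (intro gdist_triangle assms)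
  also have "gdist X u' v \<le> gdist X u' v' + gdist X v' v"
    by (intro gdist_triangle assms)
  also have "gdist X v' v = gdist X v v'"
    by (intro gdist_commute assms)
  finally show ?thesis by simp
qed

theorem theorem2:
  fixes G :: "'a pair_pre_digraph" and H :: "'b pair_pre_digraph" and \<iota> :: "'a \<Rightarrow> 'b"
    and \<alpha> l :: nat and M :: "'a set"
  assumes "weakly_Helly \<alpha> G"
    and "injective_hull \<iota> G H"
    and "M \<subseteq> pverts G"
  shows "int (diam G (center G M l)) - 2 * int \<alpha> \<le> int (diam H (center H (\<iota> ` M) l))
    \<and> int (diam H (center H (\<iota> ` M) l)) \<le> int (diam G (center G M (\<alpha> + l))) + 2 * int \<alpha>"
proof -
  let ?CG = "center G M" and ?CH = "center H (\<iota> ` M)"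
    and ?rG = "rad G M" and ?rH = "rad H (\<iota> ` M)"
  note G = weakly_Helly_imp_connected[OF assms(1)]
  have Helly: "Helly H" and emb: "isometric_embedding \<iota> G H"
    using assms(2) by (auto simp: injective_hull_def)
  note H = Helly_imp_connected[OF Helly]
  have \<iota>: "\<iota> v \<in> pverts H" if "v \<in> pverts G" for v
    using emb that by (auto simp: isometric_embedding_def)
  have iso: "gdist H (\<iota> u) (\<iota> v) = gdist G u v" if "u \<in> pverts G" "v \<in> pverts G" for u v
    using emb that by (auto simp: isometric_embedding_def)
  have MG: "m \<in> pverts G" if "m \<in> M" for m using assms(3) that by blast
  have MH: "\<iota> ` M \<subseteq> pverts H" using MG \<iota> by blast
  note CG = mem_center_iff[OF G assms(3)] and CH = mem_center_iff[OF H MH]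
  have CG_verts: "?CG k \<subseteq> pverts G" and CH_verts: "?CH k \<subseteq> pverts H" for k
    by (auto simp: center_def)

  \<comment> \<open>Disks of radius \<open>?rH\<close> around \<open>M\<close> meet pairwise already
    in G, since distances within \<open>M\<close> agree in both graphs.\<close>
  have rad_G_le: "?rG \<le> ?rH + \<alpha>" if "M \<noteq> {}"
  proof -
    let ?F = "(\<lambda>m. (m, ?rH)) ` M"
    have "gdist G u v \<le> r + s" if "(u, r) \<in> ?F" "(v, s) \<in> ?F" for u r v s
      using that gdist_le_two_rad[OF H MH, of "\<iota> u" "\<iota> v"] by (auto simp: iso MG)
    moreover have "fst ` ?F \<subseteq> pverts G" using MG by auto
    ultimately obtain x where "x \<in> pverts G" "\<And>v r. (v, r) \<in> ?F \<Longrightarrow> gdist G x v \<le> r + \<alpha>"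
      using weakly_Helly_common_vertex[OF assms(1), of ?F] by blast
    then show ?thesis using rad_le[OF G assms(3) that, of x] by blast
  qed
  \<comment> \<open>A central vertex of G keeps its distances to \<open>M\<close> in H.\<close>
  have rad_H_le: "?rH \<le> ?rG" if "M \<noteq> {}"
  proof -
    obtain c where "c \<in> ?CG 0" using center_nonempty[OF G] by blast
    then have c: "c \<in> pverts G" "\<And>m. m \<in> M \<Longrightarrow> gdist G c m \<le> ?rG"
      unfolding CG by auto
    show ?thesis
      by (rule rad_le[OF H MH _ \<iota>[OF c(1)]]) (use that c MG in \<open>auto simp: iso\<close>)
  qed

  have near_H: "\<exists>u'\<in>?CH l. gdist H (\<iota> u) u' \<le> \<alpha>" if "u \<in> ?CG l" for u
  proof -
    have u: "u \<in> pverts G" "\<And>m. m \<in> M \<Longrightarrow> gdist G u m \<le> ?rG + l"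
      using that unfolding CG by auto
    have um: "gdist G u m \<le> \<alpha> + (?rH + l)" "gdist G m u \<le> \<alpha> + (?rH + l)" if "m \<in> M" for m
    proof -
      show "gdist G u m \<le> \<alpha> + (?rH + l)"
        using u(2)[OF that] rad_G_le that by fastforce
      then show "gdist G m u \<le> \<alpha> + (?rH + l)"
        using gdist_commute[OF G u(1) MG[OF that]] by simp
    qed
    have mm: "gdist G m m' \<le> ?rH + l + (?rH + l)" if "m \<in> M" "m' \<in> M" for m m'
      using gdist_le_two_rad[OF H MH, of "\<iota> m" "\<iota> m'"] that by (simp add: iso MG)
    \<comment> \<open>A common vertex is within \<alpha> of \<open>u\<close> by the first disk and
      in the center of H by the others. The first disk meets the others because
      \<open>rad_G_le\<close> bounds \<open>?rG + l\<close> by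
      \<open>?rH + \<alpha> + l\<close>.\<close>
    let ?F = "insert (\<iota> u, \<alpha>) ((\<lambda>m. (\<iota> m, ?rH + l)) ` M)"
    have "fst ` ?F \<subseteq> pverts H" using \<iota> u(1) MG by auto
    moreover have "gdist H v w \<le> r + s" if "(v, r) \<in> ?F" "(w, s) \<in> ?F" for v r w s
      using that um mm u(1) by (auto simp: iso MG add.commute)
    ultimately obtain x where x: "x \<in> pverts H" "\<And>v r. (v, r) \<in> ?F \<Longrightarrow> gdist H x v \<le> r"
      using Helly_common_vertex[OF Helly, of ?F] by metis
    then have "x \<in> ?CH l" unfolding CH by auto
    moreover have "gdist H (\<iota> u) x \<le> \<alpha>"
      using x(2)[of "\<iota> u" \<alpha>] gdist_commute[OF H x(1) \<iota>[OF u(1)]] by simp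
    ultimately show ?thesis by blast
  qed
  \<comment> \<open>Moving into G costs up to \<alpha> in eccentricity, which is why the center of G
    is widened to \<alpha> + l.\<close>
  have near_G: "\<exists>x'\<in>?CG (\<alpha> + l). gdist H x (\<iota> x') \<le> \<alpha>" if "x \<in> ?CH l" for x
  proof -
    have x: "x \<in> pverts H" "\<And>m. m \<in> M \<Longrightarrow> gdist H x (\<iota> m) \<le> ?rH + l"
      using that unfolding CH by auto
    obtain y where y: "y \<in> pverts G" "gdist H x (\<iota> y) \<le> \<alpha>"
      using injective_hull_near[OF assms(1,2) x(1)] .
    have "gdist G y m \<le> ?rG + (\<alpha> + l)" if "m \<in> M" for m
    proof -
      have "gdist G y m \<le> gdist H x (\<iota> y) + gdist H x (\<iota> m)"
        using gdist_triangle[OF H \<iota>[OF y(1)] x(1) \<iota>[OF MG[OF that]]]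
          gdist_commute[OF H x(1) \<iota>[OF y(1)]] iso[OF y(1) MG[OF that]] by simp
      moreover have "?rH \<le> ?rG" using rad_H_le that by blast
      ultimately show ?thesis using x(2)[OF that] y(2) by linarith
    qed
    then have "y \<in> ?CG (\<alpha> + l)" unfolding CG using y(1) by blast
    with y(2) show ?thesis by blast
  qed

  \<comment> \<open>Lower bound: a diametral pair of the center of G is moved into the center of H,
    each end by at most \<alpha>.\<close>
  obtain u v where uv: "u \<in> ?CG l" "v \<in> ?CG l" "diam G (?CG l) = gdist G u v"
    using diam_attained[OF G CG_verts center_nonempty[OF G]] .
  obtain u' v' where uv': "u' \<in> ?CH l" "gdist H (\<iota> u) u' \<le> \<alpha>" "v' \<in> ?CH l" "gdist H (\<iota> v) v' \<le> \<alpha>"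
    using near_H[OF uv(1)] near_H[OF uv(2)] by blast
  have "gdist H (\<iota> u) (\<iota> v) \<le> gdist H (\<iota> u) u' + gdist H u' v' + gdist H (\<iota> v) v'"
    by (rule gdist_le_via[OF H]) (use uv uv' CG_verts CH_verts \<iota> in blast)+
  moreover have "gdist H u' v' \<le> diam H (?CH l)"
    using H CH_verts uv'(1,3) by (rule diam_ge_gdist)
  moreover have "gdist H (\<iota> u) (\<iota> v) = gdist G u v"
    by (rule iso) (use uv CG_verts in blast)+
  ultimately have lower: "diam G (?CG l) \<le> diam H (?CH l) + 2 * \<alpha>"
    using uv(3) uv'(2,4) by linarith

  \<comment> \<open>Upper bound: a diametral pair of the center of H is moved into the widened
    center of G in the same way.\<close>
  obtain x y where xy: "x \<in> ?CH l" "y \<in> ?CH l" "diam H (?CH l) = gdist H x y"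
    using diam_attained[OF H CH_verts center_nonempty[OF H]] .
  obtain x' y' where xy': "x' \<in> ?CG (\<alpha> + l)" "gdist H x (\<iota> x') \<le> \<alpha>"
      "y' \<in> ?CG (\<alpha> + l)" "gdist H y (\<iota> y') \<le> \<alpha>"
    using near_G[OF xy(1)] near_G[OF xy(2)] by blast
  have "gdist H x y \<le> gdist H x (\<iota> x') + gdist H (\<iota> x') (\<iota> y') + gdist H y (\<iota> y')"
    by (rule gdist_le_via[OF H]) (use xy xy' CG_verts CH_verts \<iota> in blast)+
  moreover have "gdist G x' y' \<le> diam G (?CG (\<alpha> + l))"
    using G CG_verts xy'(1,3) by (rule diam_ge_gdist)
  moreover have "gdist H (\<iota> x') (\<iota> y') = gdist G x' y'"
    by (rule iso) (use xy' CG_verts in blast)+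
  ultimately have "diam H (?CH l) \<le> diam G (?CG (\<alpha> + l)) + 2 * \<alpha>"
    using xy(3) xy'(2,4) by linarith
  with lower show ?thesis by linarith
qed

end
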